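(* Let $m\ge 1$, let $p\in\mathbb{R}^m$ and let $X\subseteq\mathbb{R}^m$ be an at most countable (finite or countable) set such that $p\notin X$. Let $k\ge 1$ be any integer and let $T:\mathbb{R}^m\to\mathbb{R}^k$ be a Gaussian random projection. Then $T(p)\notin T(X)$ almost surely, i.e. $\mathrm{Prob}\big(T(p)\notin T(X)\big)=1$.
   Context: A Gaussian random projection $T:\mathbb{R}^m\to\mathbb{R}^k$ is the random linear map given by a $k\times m$ matrix whose entries are sampled independently from the standard normal distribution $\mathcal{N}(0,1)$. For a set $X\subseteq \mathbb{R}^m$, $T(X)=\{T(x) : x\in X\}$. *)

theory Defs
  imports "HOL-Probability.Probability"
begin

text \<open>
  The number of rows \<open>k\<close> and of columns \<open>m\<close> are the cardinalities of the index types
  \<open>'k\<close> and \<open>'m\<close>; both are at least 1, since types are nonempty.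
\<close>

definition gaussian_matrix :: "'w measure \<Rightarrow> ('w \<Rightarrow> real^'m^'k) \<Rightarrow> bool" where
  "gaussian_matrix M A \<longleftrightarrow>
     prob_space M \<and>
     prob_space.indep_vars M (\<lambda>_. borel) (\<lambda>(i, j) \<omega>. A \<omega> $ i $ j) (UNIV :: ('k \<times> 'm) set) \<and>
     (\<forall>i j. distributed M lborel (\<lambda>\<omega>. A \<omega> $ i $ j) std_normal_density)"

definition gaussian_random_projection ::
    "'w measure \<Rightarrow> ('w \<Rightarrow> real^'m \<Rightarrow> real^'k) \<Rightarrow> bool" where
  "gaussian_random_projection M T \<longleftrightarrow>
     (\<exists>A. gaussian_matrix M A \<and> (\<forall>\<omega>\<in>space M. \<forall>x. T \<omega> x = A \<omega> *v x))"

end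

theory Submission imports Defs begin

text \<open>By linearity, \<open>T\<close> sends p and x to the same point exactly when the matrix
  kills p - x, which is nonzero for every x in X. For a fixed v \<noteq> 0, each coordinate of the
  image of v is a normal variable with positive variance |v|^2, so it vanishes with probability 0
  (\<open>gaussian_matrix_AE_mult_nonzero\<close>, resting on
  \<open>AE_normal_combination_nonzero\<close>). Countably many such null events, one for each x in
  X, still have a null union.\<close>

text \<open>A law with a Lebesgue density gives no mass to Lebesgue null sets, in particular to
  points.\<close>

lemma (in prob_space) AE_distributed_lborel_neq:
  fixes Y :: "'a \<Rightarrow> 'b::euclidean_space"
  assumes "distributed M lborel Y f"
  shows "AE \<omega> in M. Y \<omega> \<noteq> c"
proof -
  have Y: "Y \<in> measurable M lborel" and d: "distr M lborel Y = density lborel f"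
    and [measurable]: "f \<in> borel_measurable lborel"
    using assms by (auto simp: distributed_def)
  have "AE y in distr M lborel Y. y \<noteq> c"
    unfolding d using AE_lborel_singleton[of c] by (subst AE_density) auto
  then show ?thesis
    by (rule AE_distrD[OF Y])
qed

text \<open>Stability of the normal law: the combination is centred normal with variance the sum of
  the squared coefficients, which is positive, so its law has no atom at 0.\<close>

lemma (in prob_space) AE_normal_combination_nonzero:
  fixes Y :: "'i \<Rightarrow> 'a \<Rightarrow> real"
  assumes "finite I"
    and indep: "indep_vars (\<lambda>_. borel) Y I"
    and dist: "\<And>i. i \<in> I \<Longrightarrow> distributed M lborel (Y i) std_normal_density"
    and "\<exists>i\<in>I. c i \<noteq> 0"
  shows "AE \<omega> in M. (\<Sum>i\<in>I. c i * Y i \<omega>) \<noteq> 0"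
proof -
  \<comment> \<open>A term with zero coefficient is the constant 0, a degenerate normal without
    density. Such indices are dropped so that every summand has a positive standard deviation, as
    \<open>sum_indep_normal\<close> requires; the sum is unchanged.\<close>
  define J where "J = {i\<in>I. c i \<noteq> 0}"
  have J: "finite J" "J \<noteq> {}" "J \<subseteq> I"
    using assms(1,4) by (auto simp: J_def)
  have "distributed M lborel (\<lambda>\<omega>. c i * Y i \<omega>) (normal_density 0 \<bar>c i\<bar>)" if "i \<in> J" for i
    using normal_density_affine[OF dist[of i], where \<beta> = 0 and \<alpha> = "c i"] that
    by (auto simp: J_def)
  moreover have "indep_vars (\<lambda>_. borel) (\<lambda>i \<omega>. c i * Y i \<omega>) J"
    by (rule indep_vars_compose2[OF indep_vars_subset[OF indep J(3)]]) simp
  ultimately have "distributed M lborel (\<lambda>\<omega>. \<Sum>i\<in>J. c i * Y i \<omega>)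
      (normal_density (\<Sum>i\<in>J. 0) (sqrt (\<Sum>i\<in>J. \<bar>c i\<bar>\<^sup>2)))"
    by (intro sum_indep_normal J) (auto simp: J_def)
  then have "AE \<omega> in M. (\<Sum>i\<in>J. c i * Y i \<omega>) \<noteq> 0"
    by (rule AE_distributed_lborel_neq)
  moreover have "(\<Sum>i\<in>J. c i * Y i \<omega>) = (\<Sum>i\<in>I. c i * Y i \<omega>)" for \<omega>
    using assms(1) by (intro sum.mono_neutral_left) (auto simp: J_def)
  ultimately show ?thesis
    by simp
qed

lemma borel_measurable_gaussian_matrix_entry:
  assumes "gaussian_matrix M A"
  shows "(\<lambda>\<omega>. A \<omega> $ i $ j) \<in> borel_measurable M"
proof -
  have "distributed M lborel (\<lambda>\<omega>. A \<omega> $ i $ j) std_normal_density"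
    using assms by (simp add: gaussian_matrix_def)
  then show ?thesis
    by (simp add: distributed_def)
qed

text \<open>A single row suffices: one nonzero coordinate makes the product nonzero, and coordinate
  i combines the independent entries of row i with the entries of v as coefficients.\<close>

lemma gaussian_matrix_AE_mult_nonzero:
  fixes A :: "'w \<Rightarrow> real^'m^'k"
  assumes A: "gaussian_matrix M A" and "v \<noteq> 0"
  shows "AE \<omega> in M. A \<omega> *v v \<noteq> 0"
proof -
  interpret prob_space M
    using A by (simp add: gaussian_matrix_def)
  fix i :: 'k
  let ?Y = "\<lambda>(i, j) \<omega>. A \<omega> $ i $ j"
  \<comment> \<open>Row i stays indexed by pairs, as a slice of the full index set, so its
    independence is inherited from that of the whole matrix.\<close>
  have indep: "indep_vars (\<lambda>_. borel) ?Y ({i} \<times> UNIV)"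
    using A by (auto simp: gaussian_matrix_def intro: indep_vars_subset)
  have "\<exists>q\<in>{i} \<times> UNIV. v $ snd q \<noteq> 0"
    using \<open>v \<noteq> 0\<close> by (auto simp: vec_eq_iff)
  then have "AE \<omega> in M. (\<Sum>q\<in>{i} \<times> UNIV. v $ snd q * ?Y q \<omega>) \<noteq> 0"
    using A by (intro AE_normal_combination_nonzero[OF _ indep]) (auto simp: gaussian_matrix_def)
  moreover have "(\<Sum>q\<in>{i} \<times> UNIV. v $ snd q * ?Y q \<omega>) = (A \<omega> *v v) $ i" for \<omega>
  proof -
    have "{i} \<times> (UNIV :: 'm set) = Pair i ` UNIV"
      by auto
    then show ?thesis
      by (simp add: sum.reindex inj_on_def matrix_vector_mult_def mult.commute)
  qed
  ultimately show ?thesis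
    by (auto elim: AE_mp)
qed

theorem proposition2p1:
  fixes M :: "'w measure"
    and T :: "'w \<Rightarrow> real^'m \<Rightarrow> real^'k"
    and p :: "real^'m"
    and X :: "(real^'m) set"
  assumes "countable X"
    and "p \<notin> X"
    and "gaussian_random_projection M T"
  shows "\<P>(\<omega> in M. T \<omega> p \<notin> T \<omega> ` X) = 1"
proof -
  obtain A where A: "gaussian_matrix M A" and T: "\<And>\<omega> x. \<omega> \<in> space M \<Longrightarrow> T \<omega> x = A \<omega> *v x"
    using assms(3) by (auto simp: gaussian_random_projection_def)
  interpret prob_space M
    using A by (simp add: gaussian_matrix_def)
  note [measurable] = borel_measurable_gaussian_matrix_entry[OF A]
  have T_iff: "T \<omega> p \<notin> T \<omega> ` X \<longleftrightarrow> (\<forall>x\<in>X. A \<omega> *v (p - x) \<noteq> 0)" if "\<omega> \<in> space M" for \<omega>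
    using that by (auto simp: T matrix_vector_mult_diff_distrib)
  have "AE \<omega> in M. A \<omega> *v (p - x) \<noteq> 0" if "x \<in> X" for x
    using that assms(2) by (intro gaussian_matrix_AE_mult_nonzero[OF A]) auto
  then have "AE \<omega> in M. \<forall>x\<in>X. A \<omega> *v (p - x) \<noteq> 0"
    using assms(1) by (simp add: AE_ball_countable)
  \<comment> \<open>Passing from almost surely to probability 1 requires a measurable event; this
    one is a countable intersection of conditions on finitely many matrix entries.\<close>
  moreover have "{\<omega> \<in> space M. \<forall>x\<in>X. A \<omega> *v (p - x) \<noteq> 0} \<in> events"
  proof (rule sets.sets_Collect_countable_All'[OF _ assms(1)])
    show "{\<omega> \<in> space M. A \<omega> *v (p - x) \<noteq> 0} \<in> events" for x
      unfolding vec_eq_iff matrix_vector_mult_def by simp measurable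
  qed
  ultimately have "\<P>(\<omega> in M. \<forall>x\<in>X. A \<omega> *v (p - x) \<noteq> 0) = 1"
    by (simp add: prob_Collect_eq_1)
  \<comment> \<open>\<open>T\<close> agrees with the matrix only on \<open>space M\<close>, so the
    two conditions are compared as subsets of it.\<close>
  also have "{\<omega> \<in> space M. \<forall>x\<in>X. A \<omega> *v (p - x) \<noteq> 0} = {\<omega> \<in> space M. T \<omega> p \<notin> T \<omega> ` X}"
    using T_iff by auto
  finally show ?thesis .
qed

end
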